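(* Let $(\mathfrak{g},[\cdot,\cdot]_{\mathfrak{g}})$ be a Leibniz algebra and let $(V,l,r)$ be a representation of $\mathfrak{g}$ on a finite-dimensional vector space $V$. Then the linear map $$\rho=(l^*\otimes 1+1\otimes l)+r:\ \mathfrak{g}\longrightarrow \mathfrak{gl}(V^*\otimes V)\oplus (V^*\otimes V)=\mathfrak{ol}(V^*\otimes V),\qquad \rho(x)=(l^*\otimes 1+1\otimes l)_x+r_x,$$ where $r_x\in\mathfrak{gl}(V)$ is regarded as an element of $V^*\otimes V\cong\mathfrak{gl}(V)$, is an omni-representation of $\mathfrak{g}$ on $V^*\otimes V$.
   Context: All vector spaces are over $\mathbb{R}$. A Leibniz algebra is a vector space $\mathfrak{g}$ with a bilinear bracket $[\cdot,\cdot]_{\mathfrak{g}}$ satisfying $[x,[y,z]_{\mathfrak{g}}]_{\mathfrak{g}}=[[x,y]_{\mathfrak{g}},z]_{\mathfrak{g}}+[y,[x,z]_{\mathfrak{g}}]_{\mathfrak{g}}$ for all $x,y,z\in\mathfrak{g}$. A representation of $\mathfrak{g}$ is a triple $(V,l,r)$ with $V$ a vector space and $l,r:\mathfrak{g}\to\mathfrak{gl}(V)$ linear maps such that for all $x,y\in\mathfrak{g}$: $l_{[x,y]_{\mathfrak{g}}}=[l_x,l_y]$, $r_{[x,y]_{\mathfrak{g}}}=[l_x,r_y]$, $r_y\circ l_x=-r_y\circ r_x$ (here $[\cdot,\cdot]$ on $\mathfrak{gl}(V)$ is the commutator). For a vector space $W$, the omni-Lie algebra $\mathfrak{ol}(W)$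 is the vector space $\mathfrak{gl}(W)\oplus W$ with the bracket $\{A+u,B+v\}=[A,B]+Av$ for $A,B\in\mathfrak{gl}(W)$, $u,v\in W$; it is a Leibniz algebra. An omni-representation of $\mathfrak{g}$ on $W$ is a Leibniz algebra homomorphism $\rho:\mathfrak{g}\to\mathfrak{ol}(W)$, i.e. a linear map with $\rho([x,y]_{\mathfrak{g}})=\{\rho(x),\rho(y)\}$. Define $l^*:\mathfrak{g}\to\mathfrak{gl}(V^* )$ by $\langle l^*_x\xi,u\rangle=-\langle\xi,l_xu\rangle$ for $\xi\in V^*,u\in V$, and $l^*\otimes 1+1\otimes l:\mathfrak{g}\to\mathfrak{gl}(V^*\otimes V)$ by $(l^*\otimes 1+1\otimes l)_x(\xi\otimes u)=(l_x^*\xi)\otimes u+\xi\otimes l_xu$. The identification $V^*\otimes V\cong\mathfrak{gl}(V)$ sends $\xi\otimes u$ to the linear map $v\mapsto\langle\xi,v\rangle u$. *)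

theory Defs
  imports "HOL-Analysis.Analysis" "HOL-Analysis.Finite_Function_Topology"
begin

section \<open>Spaces of linear maps\<close>

text \<open>No topology is involved: \<open>linear\<close> is plain \<open>\<real>\<close>-linearity and the spaces may be
  infinite-dimensional.\<close>

typedef (overloaded) ('a::real_vector, 'b::real_vector) lin = "{f :: 'a \<Rightarrow> 'b. linear f}"
  morphisms lin_apply Lin
  by (rule exI[of _ "\<lambda>_. 0"]) (simp add: linear_iff)

setup_lifting type_definition_lin

lemma linear_lin_apply: "linear (lin_apply f)"
  using lin_apply[of f] by simp

lemma lin_apply_Lin [simp]: "linear f \<Longrightarrow> lin_apply (Lin f) = f"
  by (simp add: Lin_inverse)

lemma lin_eqI: "(\<And>x. lin_apply f x = lin_apply g x) \<Longrightarrow> f = g"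
  by (simp add: lin_apply_inject[symmetric] fun_eq_iff)

instantiation lin :: (real_vector, real_vector) real_vector
begin

lift_definition zero_lin :: "('a, 'b) lin" is "\<lambda>_. 0"
  by (simp add: linear_iff)

lift_definition plus_lin :: "('a, 'b) lin \<Rightarrow> ('a, 'b) lin \<Rightarrow> ('a, 'b) lin" is "\<lambda>f g x. f x + g x"
  by (simp add: linear_compose_add)

lift_definition minus_lin :: "('a, 'b) lin \<Rightarrow> ('a, 'b) lin \<Rightarrow> ('a, 'b) lin" is "\<lambda>f g x. f x - g x"
  by (simp add: linear_compose_sub)

lift_definition uminus_lin :: "('a, 'b) lin \<Rightarrow> ('a, 'b) lin" is "\<lambda>f x. - f x"
  by (simp add: linear_compose_neg)

lift_definition scaleR_lin :: "real \<Rightarrow> ('a, 'b) lin \<Rightarrow> ('a, 'b) lin" is "\<lambda>c f x. c *\<^sub>R f x"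
  by (simp add: linear_compose_scale_right)

instance
  by standard (transfer; simp add: fun_eq_iff algebra_simps)+

end

lemma lin_apply_simps [simp]:
  "lin_apply 0 x = 0"
  "lin_apply (f + g) x = lin_apply f x + lin_apply g x"
  "lin_apply (f - g) x = lin_apply f x - lin_apply g x"
  "lin_apply (- f) x = - lin_apply f x"
  "lin_apply (c *\<^sub>R f) x = c *\<^sub>R lin_apply f x"
  by (transfer; simp)+

lemma lin_apply_arg [simp]:
  "lin_apply f 0 = 0"
  "lin_apply f (x + y) = lin_apply f x + lin_apply f y"
  "lin_apply f (x - y) = lin_apply f x - lin_apply f y"
  "lin_apply f (- x) = - lin_apply f x"
  "lin_apply f (c *\<^sub>R x) = c *\<^sub>R lin_apply f x"
  by (simp_all add: linear_lin_apply linear_0 linear_add linear_diff linear_neg linear_scale)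

lift_definition lin_comp ::
  "('b::real_vector, 'c::real_vector) lin \<Rightarrow> ('a::real_vector, 'b) lin \<Rightarrow> ('a, 'c) lin"
  is "\<lambda>g f. g \<circ> f"
  by (simp add: linear_compose)

lemma lin_comp_apply [simp]: "lin_apply (lin_comp g f) x = lin_apply g (lin_apply f x)"
  by transfer simp

type_synonym 'v gl = "('v, 'v) lin"
type_synonym 'v dual = "('v, real) lin"

definition commutator :: "'v::real_vector gl \<Rightarrow> 'v gl \<Rightarrow> 'v gl" where
  "commutator A B = lin_comp A B - lin_comp B A"


section \<open>Leibniz algebras, representations and omni-representations\<close>

definition leibniz_algebra :: "('g::real_vector \<Rightarrow> 'g \<Rightarrow> 'g) \<Rightarrow> bool" where
  "leibniz_algebra br \<longleftrightarrow> bilinear br \<and>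
    (\<forall>x y z. br x (br y z) = br (br x y) z + br y (br x z))"

definition leibniz_representation ::
  "('g::real_vector \<Rightarrow> 'g \<Rightarrow> 'g) \<Rightarrow> ('g \<Rightarrow> 'v::real_vector gl) \<Rightarrow> ('g \<Rightarrow> 'v gl) \<Rightarrow> bool" where
  "leibniz_representation br l r \<longleftrightarrow> linear l \<and> linear r \<and>
    (\<forall>x y. l (br x y) = commutator (l x) (l y)) \<and>
    (\<forall>x y. r (br x y) = commutator (l x) (r y)) \<and>
    (\<forall>x y. lin_comp (r y) (l x) = - lin_comp (r y) (r x))"

definition leibniz_hom ::
  "('g::real_vector \<Rightarrow> 'g \<Rightarrow> 'g) \<Rightarrow> ('h::real_vector \<Rightarrow> 'h \<Rightarrow> 'h) \<Rightarrow> ('g \<Rightarrow> 'h) \<Rightarrow> bool" where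
  "leibniz_hom br br' f \<longleftrightarrow> linear f \<and> (\<forall>x y. f (br x y) = br' (f x) (f y))"

type_synonym 'w ol = "'w gl \<times> 'w"

definition ol_bracket :: "'w::real_vector ol \<Rightarrow> 'w ol \<Rightarrow> 'w ol" where
  "ol_bracket = (\<lambda>(A, u) (B, v). (commutator A B, lin_apply A v))"

lemma leibniz_algebra_ol: "leibniz_algebra (ol_bracket :: 'w::real_vector ol \<Rightarrow> _)"
  unfolding leibniz_algebra_def bilinear_def linear_iff ol_bracket_def commutator_def
  by (auto simp: split_beta intro!: lin_eqI prod_eqI simp: algebra_simps)

definition omni_representation ::
  "('g::real_vector \<Rightarrow> 'g \<Rightarrow> 'g) \<Rightarrow> ('g \<Rightarrow> 'w::real_vector ol) \<Rightarrow> bool" where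
  "omni_representation br \<rho> \<longleftrightarrow> leibniz_hom br ol_bracket \<rho>"


section \<open>The tensor product of two real vector spaces\<close>

text \<open>The free real vector space on \<open>A \<times> B\<close>, here \<open>('a \<times> 'b) \<Rightarrow>\<^sub>0 real\<close>, modulo the subspace
  spanned by the bilinearity relations.\<close>

definition free_gen :: "'a \<Rightarrow> 'b \<Rightarrow> ('a \<times> 'b) \<Rightarrow>\<^sub>0 real" where
  "free_gen a b = Poly_Mapping.single (a, b) 1"

definition tensor_null :: "(('a::real_vector \<times> 'b::real_vector) \<Rightarrow>\<^sub>0 real) set" where
  "tensor_null = span
    ({free_gen (a + a') b - free_gen a b - free_gen a' b | a a' b. True} \<union>
     {free_gen a (b + b') - free_gen a b - free_gen a b' | a b b'. True} \<union>
     {free_gen (c *\<^sub>R a) b - c *\<^sub>R free_gen a b | c a b. True} \<union>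
     {free_gen a (c *\<^sub>R b) - c *\<^sub>R free_gen a b | c a b. True})"

definition tensor_eq ::
  "(('a::real_vector \<times> 'b::real_vector) \<Rightarrow>\<^sub>0 real) \<Rightarrow> (('a \<times> 'b) \<Rightarrow>\<^sub>0 real) \<Rightarrow> bool" where
  "tensor_eq p q \<longleftrightarrow> p - q \<in> tensor_null"

lemma subspace_tensor_null: "subspace tensor_null"
  by (simp add: tensor_null_def)

lemma equivp_tensor_eq:
  "equivp (tensor_eq :: (('a::real_vector \<times> 'b::real_vector) \<Rightarrow>\<^sub>0 real) \<Rightarrow> _)"
proof (rule equivpI)
  show "reflp (tensor_eq :: (('a \<times> 'b) \<Rightarrow>\<^sub>0 real) \<Rightarrow> _)"
    by (simp add: reflp_def tensor_eq_def subspace_0[OF subspace_tensor_null])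
  show "symp (tensor_eq :: (('a \<times> 'b) \<Rightarrow>\<^sub>0 real) \<Rightarrow> _)"
    unfolding symp_def tensor_eq_def
    by (metis minus_diff_eq subspace_neg[OF subspace_tensor_null])
  show "transp (tensor_eq :: (('a \<times> 'b) \<Rightarrow>\<^sub>0 real) \<Rightarrow> _)"
  proof (rule transpI)
    fix p q s :: "('a \<times> 'b) \<Rightarrow>\<^sub>0 real"
    assume "tensor_eq p q" "tensor_eq q s"
    then have "(p - q) + (q - s) \<in> tensor_null"
      unfolding tensor_eq_def by (rule subspace_add[OF subspace_tensor_null])
    then show "tensor_eq p s" by (simp add: tensor_eq_def)
  qed
qed

quotient_type (overloaded) ('a, 'b) tensor =
  "('a::real_vector \<times> 'b::real_vector) \<Rightarrow>\<^sub>0 real" / tensor_eq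
  morphisms rep_tensor abs_tensor
  by (rule equivp_tensor_eq)

instantiation tensor :: (real_vector, real_vector) real_vector
begin

lift_definition zero_tensor :: "('a, 'b) tensor" is 0 .

lift_definition plus_tensor :: "('a, 'b) tensor \<Rightarrow> ('a, 'b) tensor \<Rightarrow> ('a, 'b) tensor" is "(+)"
  unfolding tensor_eq_def
  by (simp only: add_diff_add subspace_add[OF subspace_tensor_null])

lift_definition minus_tensor :: "('a, 'b) tensor \<Rightarrow> ('a, 'b) tensor \<Rightarrow> ('a, 'b) tensor" is "(-)"
  unfolding tensor_eq_def
proof -
  fix p q p' q' :: "('a \<times> 'b) \<Rightarrow>\<^sub>0 real"
  assume "p - q \<in> tensor_null" "p' - q' \<in> tensor_null"
  then have "(p - q) - (p' - q') \<in> tensor_null"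
    by (rule subspace_diff[OF subspace_tensor_null])
  then show "p - p' - (q - q') \<in> tensor_null" by (simp add: algebra_simps)
qed

lift_definition uminus_tensor :: "('a, 'b) tensor \<Rightarrow> ('a, 'b) tensor" is "uminus"
  unfolding tensor_eq_def
proof -
  fix p q :: "('a \<times> 'b) \<Rightarrow>\<^sub>0 real"
  assume "p - q \<in> tensor_null"
  then have "- (p - q) \<in> tensor_null"
    by (rule subspace_neg[OF subspace_tensor_null])
  then show "- p - - q \<in> tensor_null" by (simp add: algebra_simps)
qed

lift_definition scaleR_tensor :: "real \<Rightarrow> ('a, 'b) tensor \<Rightarrow> ('a, 'b) tensor" is "scaleR"
  unfolding tensor_eq_def
  by (simp only: scaleR_diff_right[symmetric] subspace_scale[OF subspace_tensor_null])

instance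
proof
  fix x y z :: "('a, 'b) tensor" and a b :: real
  have eq: "tensor_eq p q" if "p = q" for p q :: "('a \<times> 'b) \<Rightarrow>\<^sub>0 real"
    using that by (simp add: tensor_eq_def subspace_0[OF subspace_tensor_null])
  show "x + y + z = x + (y + z)" by transfer (rule eq, simp add: algebra_simps)
  show "x + y = y + x" by transfer (rule eq, simp add: algebra_simps)
  show "0 + x = x" by transfer (rule eq, simp)
  show "- x + x = 0" by transfer (rule eq, simp)
  show "x - y = x + - y" by transfer (rule eq, simp)
  show "a *\<^sub>R (x + y) = a *\<^sub>R x + a *\<^sub>R y" by transfer (rule eq, simp add: scaleR_add_right)
  show "(a + b) *\<^sub>R x = a *\<^sub>R x + b *\<^sub>R x" by transfer (rule eq, simp add: scaleR_add_left)
  show "a *\<^sub>R b *\<^sub>R x = (a * b) *\<^sub>R x" by transfer (rule eq, simp)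
  show "1 *\<^sub>R x = x" by transfer (rule eq, simp)
qed

end

lift_definition tensor_of :: "'a::real_vector \<Rightarrow> 'b::real_vector \<Rightarrow> ('a, 'b) tensor"
  (infixr \<open>\<otimes>\<close> 70) is free_gen .

definition free_lift :: "('a \<Rightarrow> 'b \<Rightarrow> 'c::real_vector) \<Rightarrow> (('a \<times> 'b) \<Rightarrow>\<^sub>0 real) \<Rightarrow> 'c" where
  "free_lift h p = (\<Sum>(a, b)\<in>Poly_Mapping.keys p. Poly_Mapping.lookup p (a, b) *\<^sub>R h a b)"

text \<open>The linear map with \<open>a \<otimes> b \<mapsto> h a b\<close>; meaningful for bilinear \<open>h\<close> only, since otherwise the
  value depends on the representative chosen by \<open>rep_tensor\<close>.\<close>

definition tensor_lift ::
  "('a::real_vector \<Rightarrow> 'b::real_vector \<Rightarrow> 'c::real_vector) \<Rightarrow> ('a, 'b) tensor \<Rightarrow> 'c" where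
  "tensor_lift h t = free_lift h (rep_tensor t)"

lemma tensor_eq_relations:
  "tensor_eq (free_gen (a + a') b) (free_gen a b + free_gen a' b)"
  "tensor_eq (free_gen a (b + b')) (free_gen a b + free_gen a b')"
  "tensor_eq (free_gen (c *\<^sub>R a) b) (c *\<^sub>R free_gen a b)"
  "tensor_eq (free_gen a (c *\<^sub>R b)) (c *\<^sub>R free_gen a b)"
  unfolding tensor_eq_def tensor_null_def diff_diff_eq[symmetric]
  by (rule span_base, blast)+

lemma bilinear_tensor_of: "bilinear (\<otimes>)"
proof -
  have "(a + a') \<otimes> b = a \<otimes> b + a' \<otimes> b" for a a' :: 'a and b :: 'b
    by transfer (rule tensor_eq_relations)
  moreover have "a \<otimes> (b + b') = a \<otimes> b + a \<otimes> b'" for a :: 'a and b b' :: 'b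
    by transfer (rule tensor_eq_relations)
  moreover have "(c *\<^sub>R a) \<otimes> b = c *\<^sub>R (a \<otimes> b)" for c and a :: 'a and b :: 'b
    by transfer (rule tensor_eq_relations)
  moreover have "a \<otimes> (c *\<^sub>R b) = c *\<^sub>R (a \<otimes> b)" for c and a :: 'a and b :: 'b
    by transfer (rule tensor_eq_relations)
  ultimately show ?thesis by (simp add: bilinear_def linear_iff)
qed

lemma lookup_scaleR_free:
  "Poly_Mapping.lookup (c *\<^sub>R p) k = c *\<^sub>R Poly_Mapping.lookup (p :: 'a \<Rightarrow>\<^sub>0 real) k"
proof -
  have "finite {i. c *\<^sub>R Poly_Mapping.lookup p i \<noteq> 0}"
    by (rule finite_subset[OF _ finite_lookup[of p]]) auto
  then show ?thesis by (simp add: scaleR_poly_mapping_def)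
qed

lemma free_lift_superset:
  assumes "finite K" "Poly_Mapping.keys p \<subseteq> K"
  shows "free_lift h p = (\<Sum>(a, b)\<in>K. Poly_Mapping.lookup p (a, b) *\<^sub>R h a b)"
  unfolding free_lift_def
  by (rule sum.mono_neutral_left) (use assms in \<open>auto simp: in_keys_iff\<close>)

lemma linear_free_lift: "linear (free_lift h)"
proof (rule linearI)
  fix p q :: "('a \<times> 'b) \<Rightarrow>\<^sub>0 real" and c :: real
  let ?K = "Poly_Mapping.keys p \<union> Poly_Mapping.keys q"
  have "free_lift h (p + q) = (\<Sum>(a, b)\<in>?K. Poly_Mapping.lookup (p + q) (a, b) *\<^sub>R h a b)"
    by (rule free_lift_superset) (auto dest: subsetD[OF keys_add])
  also have "\<dots> = free_lift h p + free_lift h q"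
    by (simp add: free_lift_superset[of ?K] lookup_add scaleR_add_left split_beta sum.distrib)
  finally show "free_lift h (p + q) = free_lift h p + free_lift h q" .
  have "free_lift h (c *\<^sub>R p) =
      (\<Sum>(a, b)\<in>Poly_Mapping.keys p. Poly_Mapping.lookup (c *\<^sub>R p) (a, b) *\<^sub>R h a b)"
    by (rule free_lift_superset) (auto simp: in_keys_iff lookup_scaleR_free)
  also have "\<dots> = c *\<^sub>R free_lift h p"
    by (simp add: free_lift_def lookup_scaleR_free scaleR_sum_right split_beta)
  finally show "free_lift h (c *\<^sub>R p) = c *\<^sub>R free_lift h p" .
qed

lemma free_lift_gen [simp]: "free_lift h (free_gen a b) = h a b"
  by (simp add: free_lift_def free_gen_def)

lemma free_lift_null:
  assumes h: "bilinear h" and p: "p \<in> tensor_null"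
  shows "free_lift h p = 0"
proof -
  note L = linear_free_lift[of h]
  show ?thesis
    by (rule linear_eq_0_on_span[OF L _ p[unfolded tensor_null_def]])
      (auto simp: linear_diff[OF L] linear_scale[OF L] bilinear_ladd[OF h] bilinear_radd[OF h]
        bilinear_lmul[OF h] bilinear_rmul[OF h])
qed

lemma tensor_lift_abs:
  assumes "bilinear h"
  shows "tensor_lift h (abs_tensor p) = free_lift h p"
proof -
  have "tensor_eq (rep_tensor (abs_tensor p)) p"
    using Quotient3_rep_abs[OF Quotient3_tensor] equivp_reflp[OF equivp_tensor_eq] by blast
  then have "free_lift h (rep_tensor (abs_tensor p) - p) = 0"
    by (intro free_lift_null[OF assms]) (simp add: tensor_eq_def)
  then show ?thesis
    by (simp add: tensor_lift_def linear_diff[OF linear_free_lift])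
qed

lemma tensor_lift_of [simp]: "bilinear h \<Longrightarrow> tensor_lift h (a \<otimes> b) = h a b"
  by (simp add: tensor_of.abs_eq tensor_lift_abs)

lemma linear_tensor_lift:
  assumes "bilinear h"
  shows "linear (tensor_lift h)"
proof (rule linearI)
  fix s t :: "('a, 'b) tensor" and c :: real
  obtain p where p: "s = abs_tensor p" using Quotient3_abs_rep[OF Quotient3_tensor, of s] by metis
  obtain q where q: "t = abs_tensor q" using Quotient3_abs_rep[OF Quotient3_tensor, of t] by metis
  show "tensor_lift h (s + t) = tensor_lift h s + tensor_lift h t"
    by (simp add: p q plus_tensor.abs_eq tensor_lift_abs[OF assms] linear_add[OF linear_free_lift])
  show "tensor_lift h (c *\<^sub>R s) = c *\<^sub>R tensor_lift h s"
    by (simp add: p scaleR_tensor.abs_eq tensor_lift_abs[OF assms] linear_scale[OF linear_free_lift])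
qed

lemma span_tensor_of: "span {a \<otimes> b | a b. True} = (UNIV :: ('a::real_vector, 'b::real_vector) tensor set)"
proof -
  have "t \<in> span {a \<otimes> b | a b. True}" for t :: "('a, 'b) tensor"
  proof -
    obtain p where p: "t = abs_tensor p" using Quotient3_abs_rep[OF Quotient3_tensor, of t] by metis
    have "abs_tensor p \<in> span {a \<otimes> b | a b. True}"
    proof (induction p rule: update_induct)
      case const
      show ?case
        using span_0 by (simp add: zero_tensor.abs_eq[symmetric])
    next
      case (update p k c)
      obtain a b where k: "k = (a, b)" by (cases k)
      have "Poly_Mapping.update k c p = p + c *\<^sub>R free_gen a b"
        using update by (intro poly_mapping_eqI)
          (auto simp: lookup_update lookup_add lookup_scaleR_free free_gen_def k lookup_single
            in_keys_iff when_def)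
      then have "abs_tensor (Poly_Mapping.update k c p) = abs_tensor p + c *\<^sub>R (a \<otimes> b)"
        by (simp add: plus_tensor.abs_eq scaleR_tensor.abs_eq tensor_of.abs_eq)
      moreover have "a \<otimes> b \<in> span {a \<otimes> b | a b. True}"
        by (rule span_base) blast
      ultimately show ?case
        using update by (simp add: span_add span_scale)
    qed
    then show ?thesis by (simp add: p)
  qed
  then show ?thesis by auto
qed

lemma tensor_linear_eqI:
  fixes f g :: "('a::real_vector, 'b::real_vector) tensor \<Rightarrow> 'c::real_vector"
  assumes "linear f" "linear g" "\<And>a b. f (a \<otimes> b) = g (a \<otimes> b)"
  shows "f = g"
proof
  fix t
  show "f t = g t"
    by (rule linear_eq_on_span[OF assms(1,2), where B = "{a \<otimes> b | a b. True}"])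
      (use span_tensor_of assms(3) in \<open>auto simp only: mem_Collect_eq UNIV_I\<close>)
qed


section \<open>The maps on \<open>V\<^sup>* \<otimes> V\<close>\<close>

definition dual_rep :: "('g \<Rightarrow> 'v::real_vector gl) \<Rightarrow> 'g \<Rightarrow> 'v dual gl" where
  "dual_rep l x = Lin (\<lambda>\<xi>. - lin_comp \<xi> (l x))"

lemma dual_rep_apply:
  fixes l :: "'g \<Rightarrow> 'v::real_vector gl"
  shows "lin_apply (lin_apply (dual_rep l x) \<xi>) u = - lin_apply \<xi> (lin_apply (l x) u)"
proof -
  have "linear (\<lambda>\<xi>. - lin_comp \<xi> (l x) :: 'v dual)"
    by (auto simp: linear_iff intro!: lin_eqI)
  then show ?thesis by (simp add: dual_rep_def)
qed

text \<open>\<open>l\<^sup>* \<otimes> 1 + 1 \<otimes> l\<close>\<close>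

definition tensor_rep :: "('g \<Rightarrow> 'v::real_vector gl) \<Rightarrow> 'g \<Rightarrow> ('v dual, 'v) tensor gl" where
  "tensor_rep l x =
    Lin (tensor_lift (\<lambda>\<xi> u. lin_apply (dual_rep l x) \<xi> \<otimes> u + \<xi> \<otimes> lin_apply (l x) u))"

lemma tensor_rep_apply:
  "lin_apply (tensor_rep l x) (\<xi> \<otimes> u) =
    lin_apply (dual_rep l x) \<xi> \<otimes> u + \<xi> \<otimes> lin_apply (l x) u"
proof -
  have b: "bilinear (\<lambda>\<xi> u. lin_apply (dual_rep l x) \<xi> \<otimes> u + \<xi> \<otimes> lin_apply (l x) u)"
    unfolding bilinear_def linear_iff
    by (simp add: bilinear_ladd[OF bilinear_tensor_of] bilinear_radd[OF bilinear_tensor_of]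
        bilinear_lmul[OF bilinear_tensor_of] bilinear_rmul[OF bilinear_tensor_of] scaleR_add_right)
  show ?thesis
    unfolding tensor_rep_def lin_apply_Lin[OF linear_tensor_lift[OF b]] tensor_lift_of[OF b] ..
qed

lift_definition rank_one :: "'v::real_vector dual \<Rightarrow> 'v \<Rightarrow> 'v gl" is "\<lambda>\<xi> u v. \<xi> v *\<^sub>R u"
  by (simp add: linear_iff scaleR_add_left)

lemma rank_one_apply [simp]: "lin_apply (rank_one \<xi> u) v = lin_apply \<xi> v *\<^sub>R u"
  by transfer simp

lemma bilinear_rank_one: "bilinear rank_one"
  by (auto simp: bilinear_def linear_iff algebra_simps intro!: lin_eqI)

definition gl_of_tensor :: "('v::real_vector dual, 'v) tensor \<Rightarrow> 'v gl" where
  "gl_of_tensor = tensor_lift rank_one"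

text \<open>Meaningful for finite-dimensional \<open>V\<close>, where \<open>gl_of_tensor\<close> is bijective.\<close>

definition tensor_of_gl :: "'v::real_vector gl \<Rightarrow> ('v dual, 'v) tensor" where
  "tensor_of_gl = inv gl_of_tensor"

lemma gl_of_tensor_of [simp]: "gl_of_tensor (\<xi> \<otimes> u) = rank_one \<xi> u"
  by (simp add: gl_of_tensor_def bilinear_rank_one)

lemma linear_gl_of_tensor: "linear gl_of_tensor"
  unfolding gl_of_tensor_def by (rule linear_tensor_lift[OF bilinear_rank_one])

lemma bij_gl_of_tensor:
  assumes "\<exists>B :: 'v::real_vector set. finite B \<and> span B = UNIV"
  shows "bij (gl_of_tensor :: ('v dual, 'v) tensor \<Rightarrow> 'v gl)"
proof -
  obtain B0 :: "'v set" where B0: "finite B0" "span B0 = UNIV" using assms by blast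
  obtain B where B: "B \<subseteq> B0" "independent B" "B0 \<subseteq> span B"
    using maximal_independent_subset[of B0] by blast
  have fin: "finite B" using B(1) B0(1) finite_subset by blast
  have sp: "span B = UNIV" using B(3) B0(2) by (metis span_mono span_span top.extremum_unique)
  define c where "c b = Lin (\<lambda>v. representation B v b)" for b
  have lc: "linear (\<lambda>v. representation B v b)" for b
    using B(2) sp by (intro linearI) (simp_all add: representation_add representation_scale)
  have c: "lin_apply (c b) v = representation B v b" for b v
    by (simp add: c_def lc)
  have expand: "(\<Sum>b\<in>B. lin_apply (c b) v *\<^sub>R b) = v" for v
    unfolding c using B(2) sp fin by (intro sum_representation_eq) auto
  define g where "g A = (\<Sum>b\<in>B. c b \<otimes> lin_apply A b)" for A :: "'v gl"
  note bt = bilinear_tensor_of[where 'a = "'v dual" and 'b = 'v]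
  have lg: "linear g"
    by (auto simp: g_def linear_iff bilinear_radd[OF bt] bilinear_rmul[OF bt]
        sum.distrib scaleR_sum_right)
  have lin_sum: "lin_apply (sum f S) v = (\<Sum>s\<in>S. lin_apply (f s) v)"
    for f :: "'v \<Rightarrow> ('v, 'w::real_vector) lin" and S v
    by (induction S rule: infinite_finite_induct) auto
  have 1: "gl_of_tensor (g A) = A" for A
  proof (rule lin_eqI)
    fix v
    have "lin_apply (gl_of_tensor (g A)) v = (\<Sum>b\<in>B. lin_apply (c b) v *\<^sub>R lin_apply A b)"
      by (simp add: g_def linear_sum[OF linear_gl_of_tensor] lin_sum)
    also have "\<dots> = lin_apply A (\<Sum>b\<in>B. lin_apply (c b) v *\<^sub>R b)"
      by (simp add: linear_sum[OF linear_lin_apply])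
    finally show "lin_apply (gl_of_tensor (g A)) v = lin_apply A v"
      by (simp add: expand)
  qed
  have "g \<circ> gl_of_tensor = id"
  proof (rule tensor_linear_eqI)
    show "linear (g \<circ> gl_of_tensor)" by (rule linear_compose[OF linear_gl_of_tensor lg])
    show "linear (id :: ('v dual, 'v) tensor \<Rightarrow> _)" by (simp add: linear_iff)
    fix \<xi> :: "'v dual" and u :: 'v
    have "(g \<circ> gl_of_tensor) (\<xi> \<otimes> u) = (\<Sum>b\<in>B. (lin_apply \<xi> b *\<^sub>R c b) \<otimes> u)"
      by (simp add: g_def bilinear_lmul[OF bt] bilinear_rmul[OF bt])
    also have "\<dots> = (\<Sum>b\<in>B. lin_apply \<xi> b *\<^sub>R c b) \<otimes> u"
      using bt by (simp add: bilinear_def linear_sum[of "\<lambda>x. x \<otimes> u"])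
    also have "(\<Sum>b\<in>B. lin_apply \<xi> b *\<^sub>R c b) = \<xi>"
    proof (rule lin_eqI)
      fix v
      have "lin_apply \<xi> v = lin_apply \<xi> (\<Sum>b\<in>B. lin_apply (c b) v *\<^sub>R b)" by (simp add: expand)
      also have "\<dots> = (\<Sum>b\<in>B. lin_apply (c b) v * lin_apply \<xi> b)"
        by (simp add: linear_sum[OF linear_lin_apply])
      finally show "lin_apply (\<Sum>b\<in>B. lin_apply \<xi> b *\<^sub>R c b) v = lin_apply \<xi> v"
        by (simp add: lin_sum mult.commute)
    qed
    finally show "(g \<circ> gl_of_tensor) (\<xi> \<otimes> u) = id (\<xi> \<otimes> u)" by simp
  qed
  then show ?thesis
    by (intro o_bij[of g]) (auto simp: 1 fun_eq_iff)
qed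

end

theory Submission
  imports Defs
begin

text \<open>The bracket of \<open>\<oo>\<ll>(W)\<close> has two components, so the linear map \<open>\<rho> = (l\<^sup>* \<otimes> 1 + 1 \<otimes> l) + r\<close>
  preserves brackets exactly when \<open>l\<^sup>* \<otimes> 1 + 1 \<otimes> l\<close> takes brackets to commutators in \<open>\<gg>\<ll>(V\<^sup>* \<otimes> V)\<close> and
  \<open>r\<^bsub>[x,y]\<^esub> = (l\<^sup>* \<otimes> 1 + 1 \<otimes> l)\<^sub>x r\<^sub>y\<close>, where \<open>r\<close> is read as a map into \<open>V\<^sup>* \<otimes> V\<close>.

  The first condition holds because \<open>l\<close> takes brackets to commutators and this property passes to
  duals and tensor products: the mixed terms of the commutator cancel on pure
  tensors (\<open>tensor_rep_bracket\<close>).  For the second one, the identification \<open>V\<^sup>* \<otimes> V \<cong> \<gg>\<ll>(V)\<close> turns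
  \<open>(l\<^sup>* \<otimes> 1 + 1 \<otimes> l)\<^sub>x\<close> into \<open>A \<mapsto> [l\<^sub>x, A]\<close> (\<open>gl_of_tensor_rep\<close>), so the condition reads
  \<open>r\<^bsub>[x,y]\<^esub> = [l\<^sub>x, r\<^sub>y]\<close>, which is an axiom of a representation.  Finite dimension of \<open>V\<close> enters
  because the identification must be invertible for \<open>r\<^sub>x\<close> to be read as a tensor.\<close>

lemmas tensor_of_bilinear_simps =
  bilinear_ladd[OF bilinear_tensor_of] bilinear_radd[OF bilinear_tensor_of]
  bilinear_lmul[OF bilinear_tensor_of] bilinear_rmul[OF bilinear_tensor_of]
  bilinear_lsub[OF bilinear_tensor_of] bilinear_rsub[OF bilinear_tensor_of]

lemma tensor_lin_eqI:
  fixes A B :: "(('a::real_vector, 'b::real_vector) tensor, 'c::real_vector) lin"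
  assumes "\<And>a b. lin_apply A (a \<otimes> b) = lin_apply B (a \<otimes> b)"
  shows "A = B"
proof -
  have "lin_apply A = lin_apply B"
    by (rule tensor_linear_eqI) (simp_all add: linear_lin_apply assms)
  then show ?thesis by (simp add: lin_apply_inject)
qed

lemma linear_dual_rep:
  assumes "linear l"
  shows "linear (dual_rep l)"
  by (intro linearI lin_eqI)
    (simp_all add: dual_rep_apply linear_add[OF assms] linear_scale[OF assms])

text \<open>The sign in \<open>l\<^sup>*\<close> undoes the order reversal of transposition, so that the commutator is
  preserved.\<close>

lemma dual_rep_bracket:
  assumes "l z = commutator (l x) (l y)"
  shows "dual_rep l z = commutator (dual_rep l x) (dual_rep l y)"
  by (intro lin_eqI) (simp add: dual_rep_apply assms commutator_def)

lemma linear_tensor_rep: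
  assumes "linear l"
  shows "linear (tensor_rep l)"
  by (intro linearI tensor_lin_eqI)
    (simp_all add: tensor_rep_apply tensor_of_bilinear_simps algebra_simps
      linear_add[OF assms] linear_scale[OF assms]
      linear_add[OF linear_dual_rep[OF assms]] linear_scale[OF linear_dual_rep[OF assms]])

text \<open>On a pure tensor, each of the two compositions in the commutator produces the same mixed terms
  \<open>l\<^sup>*\<^sub>x \<xi> \<otimes> l\<^sub>y u + l\<^sup>*\<^sub>y \<xi> \<otimes> l\<^sub>x u\<close>; what is left is the commutator in each factor separately.\<close>

lemma tensor_rep_bracket:
  assumes "l z = commutator (l x) (l y)"
  shows "tensor_rep l z = commutator (tensor_rep l x) (tensor_rep l y)"
  by (rule tensor_lin_eqI)
    (simp add: tensor_rep_apply dual_rep_bracket[of l z x y, OF assms] assms commutator_def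
      tensor_of_bilinear_simps)

text \<open>The identification is equivariant because \<open>l\<^sub>x \<circ> (\<xi> \<otimes> u) = \<xi> \<otimes> l\<^sub>x u\<close> and
  \<open>(\<xi> \<otimes> u) \<circ> l\<^sub>x = (\<xi> \<circ> l\<^sub>x) \<otimes> u = - l\<^sup>*\<^sub>x \<xi> \<otimes> u\<close> as endomorphisms of \<open>V\<close>.\<close>

lemma gl_of_tensor_rep:
  "gl_of_tensor (lin_apply (tensor_rep l x) t) = commutator (l x) (gl_of_tensor t)"
proof -
  have "gl_of_tensor \<circ> lin_apply (tensor_rep l x) = commutator (l x) \<circ> gl_of_tensor"
  proof (rule tensor_linear_eqI)
    show "linear (gl_of_tensor \<circ> lin_apply (tensor_rep l x))"
      by (rule linear_compose[OF linear_lin_apply linear_gl_of_tensor])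
    have "linear (commutator (l x))"
      by (intro linearI lin_eqI) (simp_all add: commutator_def algebra_simps)
    then show "linear (commutator (l x) \<circ> gl_of_tensor)"
      by (rule linear_compose[OF linear_gl_of_tensor])
    show "(gl_of_tensor \<circ> lin_apply (tensor_rep l x)) (\<xi> \<otimes> u) =
        (commutator (l x) \<circ> gl_of_tensor) (\<xi> \<otimes> u)" for \<xi> u
      by (rule lin_eqI)
        (simp add: tensor_rep_apply linear_add[OF linear_gl_of_tensor] commutator_def
          dual_rep_apply)
  qed
  then show ?thesis by (simp add: fun_eq_iff)
qed

theorem theorem3p5:
  fixes br :: "'g::real_vector \<Rightarrow> 'g \<Rightarrow> 'g"
    and l r :: "'g \<Rightarrow> 'v::real_vector gl"
  assumes "leibniz_algebra br"
    and "\<exists>B :: 'v set. finite B \<and> span B = UNIV"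
    and "leibniz_representation br l r"
  shows "omni_representation br (\<lambda>x. (tensor_rep l x, tensor_of_gl (r x)))"
proof -
  have l: "linear l" "l (br x y) = commutator (l x) (l y)"
    and r: "linear r" "r (br x y) = commutator (l x) (r y)" for x y
    using assms(3) by (simp_all add: leibniz_representation_def)
  have bij: "bij (gl_of_tensor :: ('v dual, 'v) tensor \<Rightarrow> 'v gl)"
    by (rule bij_gl_of_tensor[OF assms(2)])
  have gl_inverse: "gl_of_tensor (tensor_of_gl A) = A" for A :: "'v gl"
    unfolding tensor_of_gl_def by (rule surj_f_inv_f[OF bij_is_surj[OF bij]])
  have tensor_eqI: "s = t" if "gl_of_tensor s = gl_of_tensor t" for s t :: "('v dual, 'v) tensor"
    using that bij by (simp add: bij_def inj_eq)
  have "linear (\<lambda>x. tensor_of_gl (r x))"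
    by (intro linearI tensor_eqI)
      (simp_all add: gl_inverse linear_add[OF linear_gl_of_tensor]
        linear_scale[OF linear_gl_of_tensor] linear_add[OF r(1)] linear_scale[OF r(1)])
  then have "linear (\<lambda>x. (tensor_rep l x, tensor_of_gl (r x)))"
    using linear_tensor_rep[OF l(1)] by (simp add: linear_iff)
  moreover have "tensor_of_gl (r (br x y)) = lin_apply (tensor_rep l x) (tensor_of_gl (r y))" for x y
    by (rule tensor_eqI) (simp add: gl_inverse gl_of_tensor_rep r(2))
  ultimately show ?thesis
    by (simp add: omni_representation_def leibniz_hom_def ol_bracket_def
        tensor_rep_bracket[of l "br x y" x y for x y, OF l(2)])
qed

end
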